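(* Let $D\ge 3$, let $f>0$ be the metric function $-g_{tt}$ of the static spherically symmetric spacetime $ds^2=-f(r)dt^2+g(r)dr^2+r^2d\Omega_{D-2}^2$ ($0<f,g<\infty$), let $h(n)>0$ be an arbitrary enthalpy function (equation of state), and let $\mu\ne0$, $\omega\in\mathbb{R}$. Consider the accretion problem $F(r,n)=\mathrm{const}$, where $$F(r,n)=h(n)^2\left[f(r)+\frac{\mu^2}{r^{2(D-2)}n^2}\right]\frac{1}{1-\omega^2 f(r)r^{-2}}.$$ Then for every physical transonic accretion flow of this problem, its sonic point coincides with a critical point of $F$ on the phase space $(r,n)$ which is a saddle point.
   Context: Setting. $f,g$ are positive functions of $r>0$ on the radial interval considered, with $f$ twice continuously differentiable; $d\Omega_{D-2}^2$ is the unit round $(D-2)$-sphere metric; $h$ (the enthalpy per particle) is a positive twice continuously differentiable function of the number density $n>0$. The equation $F(r,n)=\mathrm{const}$ describes a stationary, rotating, geometrically thin disk on the equatorial plane; $\mu$ is the particle flux constant and $\omega$ the (constant) ratio of angular momentum flux to energy flux. The phase space is the set of $(r,n)$ with $r$ in the radial interval, $n>0$ and $1-\omega^2 f(r)r^{-2}>0$. Flows. A physical accretion flow is a differentiable single-valued function $n=n(r)>0$ on an open interval of radii, with graph in the phase space, along which $F(r,n(r))$ is constant. Sonic points. The squared sound speed is $v_s^2(n)=\dfrac{d\ln h}{d\ln n}$. The squared 3-velocity of the fluid, in the frame co-rotating with the fluid at fixed radius, is $v^2=\dfrac{\mu^2}{\mu^2+f(r)r^{2(D-2)}n^2}$. A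 sonic point is a phase-space point with $v^2=v_s^2$. A flow is transonic if it experiences a transition between a subsonic state ($v^2<v_s^2$) and a supersonic state ($v^2>v_s^2$); the sonic point of the flow is the point of its graph where the transition occurs, i.e. $v^2-v_s^2$ vanishes there and has opposite signs on the two sides nearby. Critical points. A critical point is a phase-space point $(r_c,n_c)$ with $\partial_rF=\partial_nF=0$. With $\det M_c=(\partial_r^2F)(\partial_n^2F)-(\partial_r\partial_nF)^2$ evaluated at $(r_c,n_c)$, critical points are classified into two types: a saddle point (two solution orbits pass through it) if $\det M_c<0$, and an extremum point (nearby orbits are closed curves around it) if $\det M_c>0$.
   Formalization: The sonic point is shown to be a critical point always, and a saddle point provided det M_c ≠ 0 there; without this nondegeneracy the saddle claim fails, since a transonic flow can pass through a critical point with det M_c = 0. *)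

theory Defs
  imports "HOL-Analysis.Analysis"
begin

definition twice_cont_diff_on :: "(real \<Rightarrow> real) \<Rightarrow> real set \<Rightarrow> bool" where
  "twice_cont_diff_on u S \<longleftrightarrow> u differentiable_on S \<and> deriv u C1_differentiable_on S"

definition pd1 :: "(real \<Rightarrow> real \<Rightarrow> real) \<Rightarrow> real \<Rightarrow> real \<Rightarrow> real" where
  "pd1 G r n = deriv (\<lambda>x. G x n) r"

definition pd2 :: "(real \<Rightarrow> real \<Rightarrow> real) \<Rightarrow> real \<Rightarrow> real \<Rightarrow> real" where
  "pd2 G r n = deriv (\<lambda>y. G r y) n"

definition hessian_det :: "(real \<Rightarrow> real \<Rightarrow> real) \<Rightarrow> real \<times> real \<Rightarrow> real" where
  "hessian_det G = (\<lambda>(r, n). pd1 (pd1 G) r n * pd2 (pd2 G) r n - (pd1 (pd2 G) r n)\<^sup>2)"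

definition accretion_F ::
  "nat \<Rightarrow> (real \<Rightarrow> real) \<Rightarrow> (real \<Rightarrow> real) \<Rightarrow> real \<Rightarrow> real \<Rightarrow> real \<Rightarrow> real \<Rightarrow> real" where
  "accretion_F D f h \<mu> \<omega> r n =
     (h n)\<^sup>2 * (f r + \<mu>\<^sup>2 / (r ^ (2 * (D - 2)) * n\<^sup>2)) * (1 / (1 - \<omega>\<^sup>2 * f r / r\<^sup>2))"

definition phase_space :: "real set \<Rightarrow> (real \<Rightarrow> real) \<Rightarrow> real \<Rightarrow> (real \<times> real) set" where
  "phase_space R f \<omega> = {(r, n). r \<in> R \<and> 0 < n \<and> 0 < 1 - \<omega>\<^sup>2 * f r / r\<^sup>2}"

definition critical_point ::
  "(real \<times> real) set \<Rightarrow> (real \<Rightarrow> real \<Rightarrow> real) \<Rightarrow> real \<times> real \<Rightarrow> bool" where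
  "critical_point P G p \<longleftrightarrow> p \<in> P \<and> pd1 G (fst p) (snd p) = 0 \<and> pd2 G (fst p) (snd p) = 0"

text \<open>Critical points with nonzero Hessian determinant are of two types: saddle points
  (negative determinant) and extremum points (positive determinant). Degenerate critical
  points belong to neither type; a transonic flow can pass through one.\<close>

definition saddle_point ::
  "(real \<times> real) set \<Rightarrow> (real \<Rightarrow> real \<Rightarrow> real) \<Rightarrow> real \<times> real \<Rightarrow> bool" where
  "saddle_point P G p \<longleftrightarrow> critical_point P G p \<and> hessian_det G p < 0"

text \<open>The logarithmic derivative \<open>d ln h / d ln n\<close>, with \<open>s = ln n\<close> as independent variable.\<close>

definition sound_speed_sq :: "(real \<Rightarrow> real) \<Rightarrow> real \<Rightarrow> real" where
  "sound_speed_sq h n = deriv (\<lambda>s. ln (h (exp s))) (ln n)"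

definition fluid_speed_sq :: "nat \<Rightarrow> (real \<Rightarrow> real) \<Rightarrow> real \<Rightarrow> real \<Rightarrow> real \<Rightarrow> real" where
  "fluid_speed_sq D f \<mu> r n = \<mu>\<^sup>2 / (\<mu>\<^sup>2 + f r * r ^ (2 * (D - 2)) * n\<^sup>2)"

definition sonic_point ::
  "nat \<Rightarrow> real set \<Rightarrow> (real \<Rightarrow> real) \<Rightarrow> (real \<Rightarrow> real) \<Rightarrow> real \<Rightarrow> real \<Rightarrow> real \<times> real \<Rightarrow> bool" where
  "sonic_point D R f h \<mu> \<omega> p \<longleftrightarrow>
     p \<in> phase_space R f \<omega> \<and> fluid_speed_sq D f \<mu> (fst p) (snd p) = sound_speed_sq h (snd p)"

definition subsonic :: "nat \<Rightarrow> (real \<Rightarrow> real) \<Rightarrow> (real \<Rightarrow> real) \<Rightarrow> real \<Rightarrow> real \<Rightarrow> real \<Rightarrow> bool" where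
  "subsonic D f h \<mu> r n \<longleftrightarrow> fluid_speed_sq D f \<mu> r n < sound_speed_sq h n"

definition supersonic :: "nat \<Rightarrow> (real \<Rightarrow> real) \<Rightarrow> (real \<Rightarrow> real) \<Rightarrow> real \<Rightarrow> real \<Rightarrow> real \<Rightarrow> bool" where
  "supersonic D f h \<mu> r n \<longleftrightarrow> sound_speed_sq h n < fluid_speed_sq D f \<mu> r n"

definition physical_flow ::
  "nat \<Rightarrow> real set \<Rightarrow> (real \<Rightarrow> real) \<Rightarrow> (real \<Rightarrow> real) \<Rightarrow> real \<Rightarrow> real \<Rightarrow>
     real set \<Rightarrow> (real \<Rightarrow> real) \<Rightarrow> bool" where
  "physical_flow D R f h \<mu> \<omega> I N \<longleftrightarrow>
     open I \<and> is_interval I \<and> I \<noteq> {} \<and> N differentiable_on I \<and>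
     (\<forall>r\<in>I. (r, N r) \<in> phase_space R f \<omega>) \<and>
     (\<lambda>r. accretion_F D f h \<mu> \<omega> r (N r)) constant_on I"

definition transonic_flow ::
  "nat \<Rightarrow> real set \<Rightarrow> (real \<Rightarrow> real) \<Rightarrow> (real \<Rightarrow> real) \<Rightarrow> real \<Rightarrow> real \<Rightarrow>
     real set \<Rightarrow> (real \<Rightarrow> real) \<Rightarrow> bool" where
  "transonic_flow D R f h \<mu> \<omega> I N \<longleftrightarrow>
     physical_flow D R f h \<mu> \<omega> I N \<and>
     (\<exists>r\<in>I. subsonic D f h \<mu> r (N r)) \<and> (\<exists>r\<in>I. supersonic D f h \<mu> r (N r))"

text \<open>Either direction of the transition is allowed. A flow may have several such points.\<close>

definition sonic_point_of_flow ::
  "nat \<Rightarrow> real set \<Rightarrow> (real \<Rightarrow> real) \<Rightarrow> (real \<Rightarrow> real) \<Rightarrow> real \<Rightarrow> real \<Rightarrow>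
     real set \<Rightarrow> (real \<Rightarrow> real) \<Rightarrow> real \<times> real \<Rightarrow> bool" where
  "sonic_point_of_flow D R f h \<mu> \<omega> I N p \<longleftrightarrow>
     fst p \<in> I \<and> snd p = N (fst p) \<and> sonic_point D R f h \<mu> \<omega> p \<and>
     ((\<forall>\<^sub>F r in at_left (fst p). subsonic D f h \<mu> r (N r)) \<and>
      (\<forall>\<^sub>F r in at_right (fst p). supersonic D f h \<mu> r (N r))
      \<or>
      (\<forall>\<^sub>F r in at_left (fst p). supersonic D f h \<mu> r (N r)) \<and>
      (\<forall>\<^sub>F r in at_right (fst p). subsonic D f h \<mu> r (N r)))"

end

theory Submission
  imports Defs
begin

text \<open>Since \<open>\<partial>\<^sub>nF = (2F/n)(v\<^sub>s\<^sup>2 - v\<^sup>2)\<close>, \<open>\<partial>\<^sub>nF\<close> vanishes at a sonic point, and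
  differentiating \<open>F(r, N(r)) = const\<close> there gives \<open>\<partial>\<^sub>rF = 0\<close>. A second-order Taylor expansion
  of \<open>F(r, N(r))\<close> at the sonic point then shows that the Hessian form of \<open>F\<close> vanishes on the
  nonzero vector \<open>(1, N')\<close>, so the Hessian is not definite and its determinant is at most \<open>0\<close>.
  As \<open>N\<close> is only once differentiable, one cannot differentiate \<open>F(r, N(r))\<close> twice; the expansion is
  obtained from \<open>F\<close> being a sum of two products of a function of \<open>r\<close> and a function of \<open>n\<close>.\<close>

section \<open>Twice differentiability at a single point\<close>

text \<open>\<open>deriv u\<close> is an unspecified value where no derivative exists, so it must be
  a true derivative on a whole neighbourhood before its own derivative at \<open>x\<close> carries
  meaning. This pointwise notion is what the Peano form of Taylor's theorem consumes.\<close>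

definition twice_differentiable_at :: "(real \<Rightarrow> real) \<Rightarrow> real \<Rightarrow> bool" where
  "twice_differentiable_at u x \<longleftrightarrow>
     (\<forall>\<^sub>F y in nhds x. u field_differentiable at y) \<and> deriv u field_differentiable at x"

lemma twice_differentiable_at_imp_field_differentiable:
  "twice_differentiable_at u x \<Longrightarrow> u field_differentiable at x"
  unfolding twice_differentiable_at_def by (blast dest: eventually_nhds_x_imp_x)

lemma twice_differentiable_at_imp_DERIV:
  "twice_differentiable_at u x \<Longrightarrow> (u has_field_derivative deriv u x) (at x)"
  using twice_differentiable_at_imp_field_differentiable field_differentiable_derivI by blast

lemma twice_differentiable_at_imp_DERIV_deriv:
  "twice_differentiable_at u x \<Longrightarrow> (deriv u has_field_derivative deriv (deriv u) x) (at x)"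
  unfolding twice_differentiable_at_def using field_differentiable_derivI by blast

text \<open>Differentiability at \<open>x\<close> depends only on the germ, so
  \<open>deriv u\<close> can be exchanged for an explicit formula \<open>u'\<close>. The closure
  rules below all rest on this.\<close>

lemma twice_differentiable_atI:
  assumes "\<forall>\<^sub>F y in nhds x. (u has_field_derivative u' y) (at y)"
    and "u' field_differentiable at x"
  shows "twice_differentiable_at u x"
proof -
  have "\<forall>\<^sub>F y in nhds x. deriv u y = u' y"
    using assms(1) by eventually_elim (rule DERIV_imp_deriv)
  then have "deriv u field_differentiable at x \<longleftrightarrow> u' field_differentiable at x"
    unfolding field_differentiable_def by (intro ex_cong1 DERIV_cong_ev) auto
  moreover have "\<forall>\<^sub>F y in nhds x. u field_differentiable at y"
    using assms(1) by eventually_elim (auto simp: field_differentiable_def)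
  ultimately show ?thesis
    using assms(2) by (simp add: twice_differentiable_at_def)
qed

text \<open>Openness turns differentiability within \<open>S\<close> into differentiability at every
  point near \<open>x\<close>; \<open>C1_differentiable_on\<close> already speaks of full
  neighbourhoods.\<close>

lemma twice_differentiable_at_open:
  assumes "twice_cont_diff_on u S" "open S" "x \<in> S"
  shows "twice_differentiable_at u x"
proof -
  have "\<forall>\<^sub>F y in nhds x. y \<in> S"
    using assms by (simp add: eventually_nhds_in_open)
  then have "\<forall>\<^sub>F y in nhds x. u field_differentiable at y"
  proof eventually_elim
    case (elim y)
    then have "u differentiable at y"
      using assms by (auto simp: twice_cont_diff_on_def differentiable_on_eq_differentiable_at)
    then show ?case
      by (auto simp: real_differentiable_def field_differentiable_def)
  qed
  moreover have "deriv u field_differentiable at x"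
    using assms
    by (auto simp: twice_cont_diff_on_def C1_differentiable_on_def field_differentiable_def
        has_real_derivative_iff_has_vector_derivative)
  ultimately show ?thesis by (simp add: twice_differentiable_at_def)
qed

lemma twice_differentiable_at_const: "twice_differentiable_at (\<lambda>x. c) x"
  by (rule twice_differentiable_atI[where u' = "\<lambda>_. 0"]) auto

lemma twice_differentiable_at_ident: "twice_differentiable_at (\<lambda>x. x) x"
  by (rule twice_differentiable_atI[where u' = "\<lambda>_. 1"]) auto

lemma twice_differentiable_at_diff:
  assumes "twice_differentiable_at u x" "twice_differentiable_at v x"
  shows "twice_differentiable_at (\<lambda>y. u y - v y) x"
proof (rule twice_differentiable_atI)
  have "\<forall>\<^sub>F y in nhds x. u field_differentiable at y \<and> v field_differentiable at y"
    using assms by (simp add: twice_differentiable_at_def eventually_conj_iff)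
  then show "\<forall>\<^sub>F y in nhds x.
      ((\<lambda>y. u y - v y) has_field_derivative deriv u y - deriv v y) (at y)"
    by eventually_elim (auto intro!: DERIV_diff field_differentiable_derivI)
  show "(\<lambda>y. deriv u y - deriv v y) field_differentiable at x"
    using assms by (auto simp: twice_differentiable_at_def intro!: field_differentiable_diff)
qed

lemma twice_differentiable_at_mult:
  assumes "twice_differentiable_at u x" "twice_differentiable_at v x"
  shows "twice_differentiable_at (\<lambda>y. u y * v y) x"
proof (rule twice_differentiable_atI)
  have "\<forall>\<^sub>F y in nhds x. u field_differentiable at y \<and> v field_differentiable at y"
    using assms by (simp add: twice_differentiable_at_def eventually_conj_iff)
  then show "\<forall>\<^sub>F y in nhds x.
      ((\<lambda>y. u y * v y) has_field_derivative deriv u y * v y + deriv v y * u y) (at y)"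
    by eventually_elim (auto intro!: DERIV_mult field_differentiable_derivI)
  show "(\<lambda>y. deriv u y * v y + deriv v y * u y) field_differentiable at x"
    using assms
    by (auto simp: twice_differentiable_at_def intro!: field_differentiable_add
        field_differentiable_mult dest: eventually_nhds_x_imp_x)
qed

lemma twice_differentiable_at_power:
  assumes "twice_differentiable_at u x"
  shows "twice_differentiable_at (\<lambda>y. u y ^ n) x"
  by (induction n) (auto intro: assms twice_differentiable_at_const twice_differentiable_at_mult)

lemma twice_differentiable_at_inverse:
  assumes "twice_differentiable_at u x" "u x \<noteq> 0"
  shows "twice_differentiable_at (\<lambda>y. inverse (u y)) x"
proof (rule twice_differentiable_atI)
  have u: "u field_differentiable at x"
    by (rule twice_differentiable_at_imp_field_differentiable[OF assms(1)])
  then have "\<forall>\<^sub>F y in nhds x. u y \<noteq> 0"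
    using assms(2) field_differentiable_imp_continuous_at[OF u]
    by (intro tendsto_imp_eventually_ne[of u "u x"])
      (auto simp: continuous_at tendsto_at_iff_tendsto_nhds)
  moreover have "\<forall>\<^sub>F y in nhds x. u field_differentiable at y"
    using assms by (simp add: twice_differentiable_at_def)
  ultimately show "\<forall>\<^sub>F y in nhds x.
      ((\<lambda>y. inverse (u y)) has_field_derivative
        - (inverse (u y) * deriv u y * inverse (u y))) (at y)"
    by eventually_elim (auto intro!: DERIV_inverse' field_differentiable_derivI)
  show "(\<lambda>y. - (inverse (u y) * deriv u y * inverse (u y))) field_differentiable at x"
    using assms u
    by (auto simp: twice_differentiable_at_def intro!: field_differentiable_minus
        field_differentiable_mult field_differentiable_inverse)
qed

lemma twice_differentiable_at_divide:
  assumes "twice_differentiable_at u x" "twice_differentiable_at v x" "v x \<noteq> 0"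
  shows "twice_differentiable_at (\<lambda>y. u y / v y) x"
  unfolding divide_inverse
  by (intro twice_differentiable_at_mult twice_differentiable_at_inverse assms)

section \<open>Second-order Taylor expansion with Peano remainder\<close>

text \<open>The remainder is absorbed into the coefficient \<open>\<rho>\<close>, so the expansion
  is an exact identity for every \<open>y\<close> and the analytic content is just the continuity of
  \<open>\<rho>\<close> at \<open>x\<close>. Exact identities can be multiplied out algebraically
  later.\<close>

lemma Taylor_Peano_second_order:
  assumes "twice_differentiable_at u x"
  obtains \<rho> where "isCont \<rho> x" and "\<rho> x = deriv (deriv u) x / 2"
    and "\<And>y. u y = u x + deriv u x * (y - x) + \<rho> y * (y - x)\<^sup>2"
proof -
  define d where "d = deriv (deriv u) x"
  define \<rho> where "\<rho> y = (if y = x then d / 2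
    else (u y - u x - deriv u x * (y - x)) / (y - x)\<^sup>2)" for y
  have ux: "(u has_field_derivative deriv u x) (at x)"
    by (rule twice_differentiable_at_imp_DERIV[OF assms])
  have nx: "\<forall>\<^sub>F y in at x. y \<noteq> x"
    by (simp add: eventually_at_filter)
  have "((\<lambda>y. (u y - u x - deriv u x * (y - x)) / (y - x)\<^sup>2) \<longlongrightarrow> d / 2) (at x)"
  proof (rule lhopital[where f' = "\<lambda>y. deriv u y - deriv u x" and g' = "\<lambda>y. 2 * (y - x)"])
    have "(u \<longlongrightarrow> u x) (at x)"
      using DERIV_isCont[OF ux] by (simp add: isCont_def)
    then show "((\<lambda>y. u y - u x - deriv u x * (y - x)) \<longlongrightarrow> 0) (at x)"
      by (auto intro!: tendsto_eq_intros)
    show "((\<lambda>y. (y - x)\<^sup>2) \<longlongrightarrow> 0) (at x)"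
      by (auto intro!: tendsto_eq_intros)
    show "\<forall>\<^sub>F y in at x. (y - x)\<^sup>2 \<noteq> 0" "\<forall>\<^sub>F y in at x. 2 * (y - x) \<noteq> 0"
      using nx by auto
    have "\<forall>\<^sub>F y in at x. u field_differentiable at y"
      using assms by (auto simp: twice_differentiable_at_def eventually_at_filter elim: eventually_mono)
    then show "\<forall>\<^sub>F y in at x.
        ((\<lambda>y. u y - u x - deriv u x * (y - x)) has_real_derivative deriv u y - deriv u x) (at y)"
      by eventually_elim (auto intro!: derivative_eq_intros field_differentiable_derivI)
    show "\<forall>\<^sub>F y in at x. ((\<lambda>y. (y - x)\<^sup>2) has_real_derivative 2 * (y - x)) (at y)"
      by (intro always_eventually allI) (auto intro!: derivative_eq_intros)
    \<comment> \<open>A single use of l'Hopital's rule suffices: what remains is half the difference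
      quotient of \<open>deriv u\<close>, which converges by the definition of the second
      derivative.\<close>
    have "((\<lambda>y. (deriv u y - deriv u x) / (y - x) / 2) \<longlongrightarrow> d / 2) (at x)"
      using twice_differentiable_at_imp_DERIV_deriv[OF assms]
      by (intro tendsto_divide) (auto simp: has_field_derivative_iff d_def)
    then show "((\<lambda>y. (deriv u y - deriv u x) / (2 * (y - x))) \<longlongrightarrow> d / 2) (at x)"
      by (simp add: mult.commute)
  qed
  then have "(\<rho> \<longlongrightarrow> d / 2) (at x)"
    by (rule Lim_transform_eventually) (use nx in eventually_elim, simp add: \<rho>_def)
  then have "isCont \<rho> x"
    by (simp add: isCont_def \<rho>_def)
  moreover have "u y = u x + deriv u x * (y - x) + \<rho> y * (y - x)\<^sup>2" for y
    by (simp add: \<rho>_def)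
  ultimately show ?thesis
    using that[of \<rho>] by (simp add: \<rho>_def d_def)
qed

section \<open>Sums of two products with separated variables\<close>

text \<open>For such a \<open>G\<close> every partial derivative is an expression in one-variable
  derivatives, so one-variable expansions of the four factors replace a two-variable Taylor
  theorem.\<close>

locale separable_sum =
  fixes G :: "real \<Rightarrow> real \<Rightarrow> real" and \<alpha> \<beta> \<gamma> \<delta> :: "real \<Rightarrow> real" and r n :: real
  assumes G_eq: "G x y = \<alpha> x * \<beta> y + \<gamma> x * \<delta> y"
    and \<alpha>: "twice_differentiable_at \<alpha> r" and \<gamma>: "twice_differentiable_at \<gamma> r"
    and \<beta>: "twice_differentiable_at \<beta> n" and \<delta>: "twice_differentiable_at \<delta> n"
begin

lemma pd1_eq:
  assumes "\<alpha> field_differentiable at x" "\<gamma> field_differentiable at x"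
  shows "pd1 G x y = deriv \<alpha> x * \<beta> y + deriv \<gamma> x * \<delta> y"
  unfolding pd1_def G_eq using assms
  by (intro DERIV_imp_deriv) (auto intro!: derivative_eq_intros field_differentiable_derivI)

lemma pd2_eq:
  assumes "\<beta> field_differentiable at y" "\<delta> field_differentiable at y"
  shows "pd2 G x y = \<alpha> x * deriv \<beta> y + \<gamma> x * deriv \<delta> y"
  unfolding pd2_def G_eq using assms
  by (intro DERIV_imp_deriv) (auto intro!: derivative_eq_intros field_differentiable_derivI)

lemmas field_differentiables = \<alpha>[THEN twice_differentiable_at_imp_field_differentiable]
  \<gamma>[THEN twice_differentiable_at_imp_field_differentiable]
  \<beta>[THEN twice_differentiable_at_imp_field_differentiable]
  \<delta>[THEN twice_differentiable_at_imp_field_differentiable]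

lemmas deriv_DERIVs = \<alpha>[THEN twice_differentiable_at_imp_DERIV_deriv]
  \<gamma>[THEN twice_differentiable_at_imp_DERIV_deriv]
  \<beta>[THEN twice_differentiable_at_imp_DERIV_deriv]
  \<delta>[THEN twice_differentiable_at_imp_DERIV_deriv]

text \<open>The formula for \<open>pd1 G\<close> is available only for \<open>x\<close> near
  \<open>r\<close>, which is enough to compute \<open>deriv\<close> at \<open>r\<close>.\<close>

lemma pd1_pd1_eq: "pd1 (pd1 G) r y = deriv (deriv \<alpha>) r * \<beta> y + deriv (deriv \<gamma>) r * \<delta> y"
proof -
  have "\<forall>\<^sub>F x in nhds r. \<alpha> field_differentiable at x \<and> \<gamma> field_differentiable at x"
    using \<alpha> \<gamma> by (simp add: twice_differentiable_at_def eventually_conj_iff)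
  then have "\<forall>\<^sub>F x in nhds r. pd1 G x y = deriv \<alpha> x * \<beta> y + deriv \<gamma> x * \<delta> y"
    by eventually_elim (simp add: pd1_eq)
  then have "pd1 (pd1 G) r y = deriv (\<lambda>x. deriv \<alpha> x * \<beta> y + deriv \<gamma> x * \<delta> y) r"
    unfolding pd1_def[of "pd1 G"] by (rule deriv_cong_ev) simp
  also have "\<dots> = deriv (deriv \<alpha>) r * \<beta> y + deriv (deriv \<gamma>) r * \<delta> y"
    by (intro DERIV_imp_deriv) (auto intro!: derivative_eq_intros deriv_DERIVs)
  finally show ?thesis .
qed

lemma pd2_pd2_eq: "pd2 (pd2 G) x n = \<alpha> x * deriv (deriv \<beta>) n + \<gamma> x * deriv (deriv \<delta>) n"
proof -
  have "\<forall>\<^sub>F y in nhds n. \<beta> field_differentiable at y \<and> \<delta> field_differentiable at y"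
    using \<beta> \<delta> by (simp add: twice_differentiable_at_def eventually_conj_iff)
  then have "\<forall>\<^sub>F y in nhds n. pd2 G x y = \<alpha> x * deriv \<beta> y + \<gamma> x * deriv \<delta> y"
    by eventually_elim (simp add: pd2_eq)
  then have "pd2 (pd2 G) x n = deriv (\<lambda>y. \<alpha> x * deriv \<beta> y + \<gamma> x * deriv \<delta> y) n"
    unfolding pd2_def[of "pd2 G"] by (rule deriv_cong_ev) simp
  also have "\<dots> = \<alpha> x * deriv (deriv \<beta>) n + \<gamma> x * deriv (deriv \<delta>) n"
    by (intro DERIV_imp_deriv) (auto intro!: derivative_eq_intros deriv_DERIVs)
  finally show ?thesis .
qed

text \<open>Here \<open>n\<close> stays fixed, so \<open>pd2_eq\<close> applies for every
  \<open>x\<close> and no neighbourhood argument enters.\<close>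

lemma pd1_pd2_eq: "pd1 (pd2 G) r n = deriv \<alpha> r * deriv \<beta> n + deriv \<gamma> r * deriv \<delta> n"
  unfolding pd1_def[of "pd2 G"] pd2_eq[OF field_differentiables(3,4)]
  by (intro DERIV_imp_deriv)
    (auto intro!: derivative_eq_intros field_differentiable_derivI field_differentiables)

text \<open>The two-variable chain rule, assembled from the one-variable chain and product rules on
  the factors.\<close>

lemma DERIV_along_curve:
  assumes N: "(N has_field_derivative m) (at r)" and "N r = n"
  shows "((\<lambda>x. G x (N x)) has_field_derivative pd1 G r n + pd2 G r n * m) (at r)"
proof -
  have "((\<lambda>x. \<beta> (N x)) has_field_derivative deriv \<beta> n * m) (at r)"
    "((\<lambda>x. \<delta> (N x)) has_field_derivative deriv \<delta> n * m) (at r)"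
    using \<open>N r = n\<close> field_differentiables(3,4)
    by (auto intro!: DERIV_chain2[OF _ N] field_differentiable_derivI)
  then show ?thesis
    unfolding G_eq pd1_eq[OF field_differentiables(1,2)] pd2_eq[OF field_differentiables(3,4)]
    using \<open>N r = n\<close>
    by (auto intro!: derivative_eq_intros field_differentiable_derivI field_differentiables
        simp: algebra_simps)
qed

text \<open>One derivative of \<open>N\<close> is enough: a deviation of \<open>N\<close> from its
  tangent enters to first order only through the factor \<open>pd2 G r n\<close>, which
  vanishes.\<close>

lemma second_order_along_curve:
  assumes N: "(N has_field_derivative m) (at r)" and Nr: "N r = n"
    and crit: "pd1 G r n = 0" "pd2 G r n = 0"
  shows "((\<lambda>x. (G x (N x) - G r n) / (x - r)\<^sup>2) \<longlongrightarrow>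
    (pd1 (pd1 G) r n + 2 * pd1 (pd2 G) r n * m + pd2 (pd2 G) r n * m\<^sup>2) / 2) (at r)"
proof -
  obtain A where A: "isCont A r" "A r = deriv (deriv \<alpha>) r / 2"
    "\<And>x. \<alpha> x = \<alpha> r + deriv \<alpha> r * (x - r) + A x * (x - r)\<^sup>2"
    using Taylor_Peano_second_order[OF \<alpha>] by blast
  obtain C where C: "isCont C r" "C r = deriv (deriv \<gamma>) r / 2"
    "\<And>x. \<gamma> x = \<gamma> r + deriv \<gamma> r * (x - r) + C x * (x - r)\<^sup>2"
    using Taylor_Peano_second_order[OF \<gamma>] by blast
  obtain B where B: "isCont B n" "B n = deriv (deriv \<beta>) n / 2"
    "\<And>y. \<beta> y = \<beta> n + deriv \<beta> n * (y - n) + B y * (y - n)\<^sup>2"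
    using Taylor_Peano_second_order[OF \<beta>] by blast
  obtain E where E: "isCont E n" "E n = deriv (deriv \<delta>) n / 2"
    "\<And>y. \<delta> y = \<delta> n + deriv \<delta> n * (y - n) + E y * (y - n)\<^sup>2"
    using Taylor_Peano_second_order[OF \<delta>] by blast
  \<comment> \<open>The difference quotient gives the exact relation
    \<open>N x - n = q x * (x - r)\<close> for \<open>x \<noteq> r\<close>, with \<open>q\<close>
    tending to \<open>m\<close>.\<close>
  define q where "q x = (N x - n) / (x - r)" for x
  have q: "(q \<longlongrightarrow> m) (at r)"
    using N by (simp add: has_field_derivative_iff q_def[abs_def] Nr)
  have NC: "isCont N r"
    by (rule DERIV_isCont[OF N])
  have lims: "(A \<longlongrightarrow> A r) (at r)" "(C \<longlongrightarrow> C r) (at r)"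
    "((\<lambda>x. B (N x)) \<longlongrightarrow> B n) (at r)" "((\<lambda>x. E (N x)) \<longlongrightarrow> E n) (at r)"
    using A(1) C(1) isCont_o2[OF NC, of B] isCont_o2[OF NC, of E] B(1) E(1) Nr
    by (auto simp: isCont_def)
  \<comment> \<open>With \<open>t = x - r\<close> and \<open>s = q x\<close>, \<open>P\<close>
    collects the terms of order at least two in \<open>t\<close> in a product of two quadratic
    expansions, divided by \<open>t\<^sup>2\<close>.\<close>
  define P where "P a0 a1 a b0 b1 b s t =
     a * b0 + a1 * b1 * s + a0 * b * s\<^sup>2 + t * (a * b1 * s + a1 * b * s\<^sup>2) + t\<^sup>2 * (a * b * s\<^sup>2)"
    for a0 a1 a b0 b1 b s t :: real
  have P: "(a0 + a1 * t + a * t\<^sup>2) * (b0 + b1 * (s * t) + b * (s * t)\<^sup>2) - a0 * b0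
      = t * (a1 * b0) + t * s * (a0 * b1) + t\<^sup>2 * P a0 a1 a b0 b1 b s t"
    for a0 a1 a b0 b1 b s t
    unfolding P_def by algebra
  have crit': "deriv \<alpha> r * \<beta> n + deriv \<gamma> r * \<delta> n = 0" "\<alpha> r * deriv \<beta> n + \<gamma> r * deriv \<delta> n = 0"
    using crit by (simp_all add: pd1_eq pd2_eq field_differentiables)
  define T where "T x = P (\<alpha> r) (deriv \<alpha> r) (A x) (\<beta> n) (deriv \<beta> n) (B (N x)) (q x) (x - r)
    + P (\<gamma> r) (deriv \<gamma> r) (C x) (\<delta> n) (deriv \<delta> n) (E (N x)) (q x) (x - r)" for x
  have T: "(G x (N x) - G r n) / (x - r)\<^sup>2 = T x" if "x \<noteq> r" for x
  proof -
    have Nx: "N x - n = q x * (x - r)"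
      using that by (simp add: q_def)
    have "G x (N x) - G r n = (\<alpha> x * \<beta> (N x) - \<alpha> r * \<beta> n) + (\<gamma> x * \<delta> (N x) - \<gamma> r * \<delta> n)"
      by (simp add: G_eq)
    \<comment> \<open>The two first-order brackets are the partial derivatives at the critical
      point, so only \<open>T\<close> survives.\<close>
    also have "\<dots> = (x - r) * (deriv \<alpha> r * \<beta> n + deriv \<gamma> r * \<delta> n)
        + (x - r) * q x * (\<alpha> r * deriv \<beta> n + \<gamma> r * deriv \<delta> n) + (x - r)\<^sup>2 * T x"
      unfolding A(3)[of x] C(3)[of x] B(3)[of "N x"] E(3)[of "N x"] Nx P T_def
      by (simp add: algebra_simps)
    finally show ?thesis
      using that crit' by simp
  qed
  \<comment> \<open>At \<open>t = 0\<close> only the quadratic terms of \<open>P\<close> remain. The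
    Peano coefficients carry the factor 1/2, while the mixed term comes from a product of first
    derivatives, hence the 2 in the Hessian form.\<close>
  have "P (\<alpha> r) (deriv \<alpha> r) (A r) (\<beta> n) (deriv \<beta> n) (B n) m (r - r)
      + P (\<gamma> r) (deriv \<gamma> r) (C r) (\<delta> n) (deriv \<delta> n) (E n) m (r - r)
    = (pd1 (pd1 G) r n + 2 * pd1 (pd2 G) r n * m + pd2 (pd2 G) r n * m\<^sup>2) / 2" (is "?L = ?Q")
    unfolding P_def pd1_pd1_eq pd1_pd2_eq pd2_pd2_eq A(2) B(2) C(2) E(2)
    by (simp add: algebra_simps add_divide_distrib)
  moreover have "(T \<longlongrightarrow> ?L) (at r)"
    unfolding T_def P_def by (intro tendsto_intros lims q)
  ultimately have "(T \<longlongrightarrow> ?Q) (at r)"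
    by (simp only:)
  then show ?thesis
    by (rule Lim_transform_eventually) (simp add: eventually_at_filter T)
qed

text \<open>Constancy of \<open>G\<close> along the curve makes the second-order quotient vanish
  near \<open>r\<close>, so its limit, half the Hessian form on \<open>(1, m)\<close>, is
  zero.\<close>

lemma level_curve_hessian_det_nonpos:
  assumes N: "(N has_field_derivative m) (at r)" "N r = n"
    and crit: "pd1 G r n = 0" "pd2 G r n = 0"
    and const: "\<forall>\<^sub>F x in at r. G x (N x) = G r n"
  shows "hessian_det G (r, n) \<le> 0"
proof -
  define a b c where "a = pd1 (pd1 G) r n" and "b = pd1 (pd2 G) r n" and "c = pd2 (pd2 G) r n"
  have "((\<lambda>x. (G x (N x) - G r n) / (x - r)\<^sup>2) \<longlongrightarrow> 0) (at r)"
    by (rule tendsto_eventually) (use const in eventually_elim, simp)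
  then have "a + 2 * b * m + c * m\<^sup>2 = 0"
    using tendsto_unique[OF _ second_order_along_curve[OF N crit]] by (fastforce simp: a_def b_def c_def)
  \<comment> \<open>Multiplying by \<open>c\<close> completes the square in
    \<open>b + c * m\<close>, with no case split on \<open>c = 0\<close>.\<close>
  then have "c * (a + 2 * b * m + c * m\<^sup>2) = 0"
    by simp
  then have "a * c - b\<^sup>2 = - (b + c * m)\<^sup>2"
    by (simp add: algebra_simps power2_eq_square)
  then show ?thesis
    by (simp add: hessian_det_def a_def b_def c_def)
qed

end

section \<open>The accretion function and its sonic points\<close>

lemma sound_speed_sq_eq:
  assumes "(h has_field_derivative h') (at n)" "0 < n" "0 < h n"
  shows "sound_speed_sq h n = n * h' / h n"
  unfolding sound_speed_sq_def
proof (rule DERIV_imp_deriv)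
  have "((\<lambda>s. h (exp s)) has_field_derivative h' * n) (at (ln n))"
    by (rule DERIV_chain2) (use assms in \<open>auto intro!: derivative_eq_intros\<close>)
  then show "((\<lambda>s. ln (h (exp s))) has_field_derivative n * h' / h n) (at (ln n))"
    using assms by (auto intro!: derivative_eq_intros simp: field_simps)
qed

text \<open>Expanding the bracket gives the two products: the rotation factor joins the functions of
  \<open>r\<close>, the factor \<open>(h n)\<^sup>2\<close> those of \<open>n\<close>. Positivity
  keeps all denominators nonzero at the base point.\<close>

lemma accretion_F_separable_sum:
  assumes "twice_differentiable_at f r" "twice_differentiable_at h n"
    and "0 < r" "0 < n" "0 < 1 - \<omega>\<^sup>2 * f r / r\<^sup>2"
  shows "separable_sum (accretion_F D f h \<mu> \<omega>)
    (\<lambda>r. f r / (1 - \<omega>\<^sup>2 * f r / r\<^sup>2)) (\<lambda>n. (h n)\<^sup>2)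
    (\<lambda>r. \<mu>\<^sup>2 / (r ^ (2 * (D - 2)) * (1 - \<omega>\<^sup>2 * f r / r\<^sup>2))) (\<lambda>n. (h n)\<^sup>2 / n\<^sup>2) r n"
proof
  show "accretion_F D f h \<mu> \<omega> x y = f x / (1 - \<omega>\<^sup>2 * f x / x\<^sup>2) * (h y)\<^sup>2
      + \<mu>\<^sup>2 / (x ^ (2 * (D - 2)) * (1 - \<omega>\<^sup>2 * f x / x\<^sup>2)) * ((h y)\<^sup>2 / y\<^sup>2)" for x y
  proof -
    \<comment> \<open>\<open>G_eq\<close> is required for all reals. The identity survives zero
      denominators because \<open>inverse\<close> is multiplicative and
      \<open>inverse 0 = 0\<close>.\<close>
    have "a * (b + c / (d * e)) * (1 / w) = b / w * a + c / (d * w) * (a / e)" for a b c d e w :: real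
      by (simp add: divide_inverse algebra_simps)
    then show ?thesis
      unfolding accretion_F_def .
  qed
qed (use assms in \<open>auto intro!: twice_differentiable_at_divide twice_differentiable_at_mult
    twice_differentiable_at_power twice_differentiable_at_diff twice_differentiable_at_const
    twice_differentiable_at_ident\<close>)

text \<open>Up to a factor, the derivative in \<open>n\<close> is the difference of the squared
  sound speed \<open>n * h' / h n\<close> and the squared fluid speed, with denominators
  cleared.\<close>

lemma pd2_accretion_F_sonic:
  assumes h: "(h has_field_derivative h') (at n)"
    and pos: "0 < r" "0 < n" "0 < h n" "0 < f r"
    and sonic: "fluid_speed_sq D f \<mu> r n = sound_speed_sq h n"
  shows "pd2 (accretion_F D f h \<mu> \<omega>) r n = 0"
proof -
  define R where "R = r ^ (2 * (D - 2))"
  define W where "W = 1 - \<omega>\<^sup>2 * f r / r\<^sup>2"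
  have R: "0 < R" using pos by (simp add: R_def)
  have "0 < \<mu>\<^sup>2 + f r * R * n\<^sup>2"
    using R pos by (simp add: add_nonneg_pos)
  moreover have "\<mu>\<^sup>2 / (\<mu>\<^sup>2 + f r * R * n\<^sup>2) = n * h' / h n"
    using sonic pos by (simp add: fluid_speed_sq_def sound_speed_sq_eq[OF h] R_def)
  ultimately have key: "\<mu>\<^sup>2 * h n = n * h' * (\<mu>\<^sup>2 + f r * R * n\<^sup>2)"
    using pos by (simp add: frac_eq_eq)
  define d where "d = 2 * h n * h' * (f r + \<mu>\<^sup>2 / (R * n\<^sup>2)) - 2 * (h n)\<^sup>2 * \<mu>\<^sup>2 / (R * n ^ 3)"
  have "((\<lambda>y. (h y)\<^sup>2 * (f r + \<mu>\<^sup>2 / (R * y\<^sup>2))) has_field_derivative d) (at n)"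
    unfolding d_def using R pos
    by (auto intro!: derivative_eq_intros h simp: field_simps power2_eq_square power3_eq_cube)
  from DERIV_cmult_right[OF this, of "1 / W"] have "pd2 (accretion_F D f h \<mu> \<omega>) r n = d * (1 / W)"
    unfolding pd2_def accretion_F_def R_def W_def by (rule DERIV_imp_deriv)
  \<comment> \<open>The last bracket is the difference of the two sides of
    \<open>key\<close>.\<close>
  also have "d = 2 * h n / (R * n ^ 3) * (n * h' * (\<mu>\<^sup>2 + f r * R * n\<^sup>2) - \<mu>\<^sup>2 * h n)"
    using R pos by (simp add: d_def field_simps power2_eq_square power3_eq_cube)
  finally show ?thesis by (simp add: key)
qed

section \<open>Sonic points of transonic flows\<close>

text \<open>The argument along the flow bounds the determinant by \<open>\<le> 0\<close> only, so
  the saddle is asserted when it is nonzero, the case covered by the classification into two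
  types.\<close>

theorem theorem1:
  fixes D :: nat and R I :: "real set" and f g h N :: "real \<Rightarrow> real"
    and \<mu> \<omega> :: real and p :: "real \<times> real"
  assumes "D \<ge> 3"
    and "open R" and "is_interval R" and "R \<subseteq> {0<..}"
    and "\<forall>r\<in>R. 0 < f r" and "\<forall>r\<in>R. 0 < g r" and "twice_cont_diff_on f R"
    and "\<forall>n>0. 0 < h n" and "twice_cont_diff_on h {0<..}"
    and "\<mu> \<noteq> 0"
    and "transonic_flow D R f h \<mu> \<omega> I N"
    and "sonic_point_of_flow D R f h \<mu> \<omega> I N p"
  shows "critical_point (phase_space R f \<omega>) (accretion_F D f h \<mu> \<omega>) p \<and>
    (hessian_det (accretion_F D f h \<mu> \<omega>) p \<noteq> 0 \<longrightarrow>
      saddle_point (phase_space R f \<omega>) (accretion_F D f h \<mu> \<omega>) p)"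
proof -
  let ?F = "accretion_F D f h \<mu> \<omega>"
  obtain r n where p: "p = (r, n)"
    by force
  have "r \<in> I" and Nr: "N r = n" and ps: "(r, n) \<in> phase_space R f \<omega>"
    and sonic: "fluid_speed_sq D f \<mu> r n = sound_speed_sq h n"
    using assms(12) by (auto simp: sonic_point_of_flow_def sonic_point_def p)
  then have "r \<in> R" "0 < r" "0 < n" "0 < 1 - \<omega>\<^sup>2 * f r / r\<^sup>2"
    using assms(4) by (auto simp: phase_space_def)
  have "open I" and "N differentiable_on I" and "(\<lambda>x. ?F x (N x)) constant_on I"
    using assms(11) by (auto simp: transonic_flow_def physical_flow_def)
  then obtain m where N: "(N has_field_derivative m) (at r)"
    using \<open>r \<in> I\<close> by (auto simp: differentiable_on_eq_differentiable_at real_differentiable_def)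
  have level: "?F x (N x) = ?F r n" if "x \<in> I" for x
    using \<open>(\<lambda>x. ?F x (N x)) constant_on I\<close> \<open>r \<in> I\<close> that Nr by (force simp: constant_on_def)
  \<comment> \<open>Local constancy of \<open>?F\<close> along the flow is used twice: for the first
    derivative and for the second-order quotient.\<close>
  have nhds: "\<forall>\<^sub>F x in nhds r. ?F x (N x) = ?F r n"
    using eventually_nhds_in_open[OF \<open>open I\<close> \<open>r \<in> I\<close>] by eventually_elim (rule level)
  have f: "twice_differentiable_at f r"
    using twice_differentiable_at_open[OF assms(7,2) \<open>r \<in> R\<close>] .
  have h: "twice_differentiable_at h n"
    using twice_differentiable_at_open[OF assms(9)] \<open>0 < n\<close> by simp
  interpret separable_sum ?F "\<lambda>r. f r / (1 - \<omega>\<^sup>2 * f r / r\<^sup>2)" "\<lambda>n. (h n)\<^sup>2"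
    "\<lambda>r. \<mu>\<^sup>2 / (r ^ (2 * (D - 2)) * (1 - \<omega>\<^sup>2 * f r / r\<^sup>2))" "\<lambda>n. (h n)\<^sup>2 / n\<^sup>2" r n
    by (rule accretion_F_separable_sum) fact+
  have pd2: "pd2 ?F r n = 0"
    using pd2_accretion_F_sonic[OF twice_differentiable_at_imp_DERIV[OF h]]
      \<open>0 < r\<close> \<open>0 < n\<close> \<open>r \<in> R\<close> sonic assms(5,8) by simp
  have "((\<lambda>x. ?F x (N x)) has_field_derivative 0) (at r)"
    using DERIV_cong_ev[OF refl nhds refl] by simp
  \<comment> \<open>The chain rule gives \<open>pd1 ?F r n + pd2 ?F r n * m = 0\<close>, and the
    sonic condition has removed the second term.\<close>
  then have pd1: "pd1 ?F r n = 0"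
    using DERIV_unique[OF DERIV_along_curve[OF N Nr]] pd2 by simp
  have "hessian_det ?F p \<le> 0"
    unfolding p using nhds
    by (intro level_curve_hessian_det_nonpos[OF N Nr pd1 pd2])
      (auto simp: eventually_at_filter elim: eventually_mono)
  then show ?thesis
    using ps pd1 pd2 by (auto simp: critical_point_def saddle_point_def p)
qed

end
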